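(* Let $\sigma=(\sigma_1,\dots,\sigma_{2n+1})=(p_0,q_1,p_1,\dots,q_n,p_n)$ be a probability distribution containing the probabilities $q_1,\dots,q_n$ of successful searches and $p_0,\dots,p_n$ of unsuccessful searches on an ordered sequence $x_1\prec\dots\prec x_n$. Let $C$ be any alphabetic code for $\sigma$, of average length $\mathbb{E}[C]$. Then one can construct in linear time a binary search tree $T$ for $\sigma$ of cost $$\mathbb{E}[T]\le\mathbb{E}[C]-\sum_{i=1}^n q_i-\sum_{i=0}^{n-1}\min(p_i,p_{i+1}).$$
   Context: A (binary) alphabetic code for $\sigma$ assigns to $2n+1$ ordered symbols, the $j$-th having probability $\sigma_j$, nonempty binary codewords so that the assignment is order preserving with respect to the alphabetical (lexicographic) order on binary strings and prefix-free; equivalently, it is a binary tree with edges labelled $0$ (left) and $1$ (right) whose leaves from left to right are $p_0,q_1,p_1,\dots,q_n,p_n$, codewords being root-to-leaf label sequences. Its average length is $\mathbb{E}[C]=\sum_{j=1}^{2n+1}\sigma_j\ell_j$, where $\ell_j$ is the length of the $j$-th codeword. A binary search tree for $x_1\prec\dots\prec x_n$ is a full binary tree with $n$ internal nodes, one for each $x_i$ (identified with $q_i$), and $n+1$ leaves, one for each of the gaps $(-\infty,x_1),(x_1,x_2),\dots,(x_n,+\infty)$ (identified with $p_0,\dots,p_n$), such that the in-order visit gives $p_0,q_1,p_1,\dots,q_n,p_n$. Its cost for $\sigma$ is $\mathbb{E}[T]=\sum_{i=1}^n q_i\,\ell(q_i)+\sum_{i=0}^n p_i\,\ell(p_i)$,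 where $\ell(q_i)$ is the level of node $q_i$ (number of nodes on the path from the root to $q_i$, so the root has level $1$) and $\ell(p_i)$ is the level of the parent of the leaf $p_i$. "Linear time" means linear in the size of the binary tree representing $C$ (which is $O(n)$ when that tree is full). *)

theory Defs
  imports Complex_Main "HOL-Library.Sublist" "HOL-Library.Tree"
begin

text \<open>The sequence \<open>\<sigma>\<^sub>1, \<dots>, \<sigma>\<^sub>2\<^sub>n\<^sub>+\<^sub>1\<close> is \<open>p\<^sub>0, q\<^sub>1, p\<^sub>1, \<dots>, q\<^sub>n, p\<^sub>n\<close>: position \<open>2i+1\<close> holds \<open>p\<^sub>i\<close> and
  position \<open>2i\<close> holds \<open>q\<^sub>i\<close>. The value \<open>q 0\<close> is never used.\<close>

definition sigma :: "(nat \<Rightarrow> real) \<Rightarrow> (nat \<Rightarrow> real) \<Rightarrow> nat \<Rightarrow> real" where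
  "sigma p q j = (if odd j then p (j div 2) else q (j div 2))"

definition distribution :: "nat \<Rightarrow> (nat \<Rightarrow> real) \<Rightarrow> (nat \<Rightarrow> real) \<Rightarrow> bool" where
  "distribution n p q \<longleftrightarrow>
     (\<forall>j\<in>{1..2*n+1}. 0 \<le> sigma p q j) \<and> (\<Sum>j=1..2*n+1. sigma p q j) = 1"

definition alphabetic_code :: "nat \<Rightarrow> (nat \<Rightarrow> bool list) \<Rightarrow> bool" where
  "alphabetic_code n C \<longleftrightarrow>
     (\<forall>j\<in>{1..2*n+1}. C j \<noteq> []) \<and>
     (\<forall>i\<in>{1..2*n+1}. \<forall>j\<in>{1..2*n+1}. i < j \<longrightarrow> (C i, C j) \<in> lexord {(False, True)}) \<and>
     (\<forall>i\<in>{1..2*n+1}. \<forall>j\<in>{1..2*n+1}. i \<noteq> j \<longrightarrow> \<not> prefix (C i) (C j))"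

definition code_cost :: "nat \<Rightarrow> (nat \<Rightarrow> real) \<Rightarrow> (nat \<Rightarrow> real) \<Rightarrow> (nat \<Rightarrow> bool list) \<Rightarrow> real" where
  "code_cost n p q C = (\<Sum>j=1..2*n+1. sigma p q j * real (length (C j)))"

text \<open>The tree of a code need not be full, so an internal node may have only a \<open>0\<close>-child
  (\<open>ZeroOnly\<close>) or only a \<open>1\<close>-child (\<open>OneOnly\<close>).\<close>

datatype 'a ctree = Symbol 'a | ZeroOnly "'a ctree" | OneOnly "'a ctree" | Branch "'a ctree" "'a ctree"

fun codewords :: "'a ctree \<Rightarrow> (bool list \<times> 'a) list" where
  "codewords (Symbol a) = [([], a)]"
| "codewords (ZeroOnly t) = map (apfst (Cons False)) (codewords t)"
| "codewords (OneOnly t) = map (apfst (Cons True)) (codewords t)"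
| "codewords (Branch l r) =
     map (apfst (Cons False)) (codewords l) @ map (apfst (Cons True)) (codewords r)"

fun nodes :: "'a ctree \<Rightarrow> nat" where
  "nodes (Symbol a) = 1"
| "nodes (ZeroOnly t) = 1 + nodes t"
| "nodes (OneOnly t) = 1 + nodes t"
| "nodes (Branch l r) = 1 + nodes l + nodes r"

text \<open>The tree representing \<open>C\<close>, with its leaves labelled \<open>1, \<dots>, 2n+1\<close>. The description is
  proper for every alphabetic code: see \<open>codewords_code_tree\<close> and \<open>codewords_inject\<close> below.\<close>

definition code_tree :: "nat \<Rightarrow> (nat \<Rightarrow> bool list) \<Rightarrow> nat ctree" where
  "code_tree n C = (THE t. codewords t = map (\<lambda>j. (C j, j)) [1..<2*n+2])"

lemma codewords_nonempty: "codewords t \<noteq> []"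
  by (induction t) auto

lemma map_Cons_append_inject:
  assumes "map (apfst (Cons False)) xs @ map (apfst (Cons True)) ys =
           map (apfst (Cons False)) xs' @ map (apfst (Cons True)) ys'"
  shows "xs = xs' \<and> ys = ys'"
proof -
  have inj: "inj (apfst (Cons b) :: bool list \<times> 'a \<Rightarrow> _)" for b
    by (auto simp: inj_def)
  have F: "filter (\<lambda>x. fst x \<noteq> [] \<and> hd (fst x) = b) (map (apfst (Cons False)) us @ map (apfst (Cons True)) vs) =
        (if b then map (apfst (Cons True)) vs else map (apfst (Cons False)) us)"
    for b and us vs :: "(bool list \<times> 'a) list"
    by (cases b) (auto simp: filter_map o_def intro!: filter_True filter_False)
  have "map (apfst (Cons False)) xs = map (apfst (Cons False)) xs'"
    using assms F[of False xs ys] F[of False xs' ys'] by simp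
  moreover have "map (apfst (Cons True)) ys = map (apfst (Cons True)) ys'"
    using assms F[of True xs ys] F[of True xs' ys'] by simp
  ultimately show ?thesis
    using inj by (simp add: inj_map_eq_map)
qed

lemma map_Cons_append_eq_iff:
  "map (apfst (Cons False)) xs @ map (apfst (Cons True)) ys =
   map (apfst (Cons False)) xs' @ map (apfst (Cons True)) ys' \<longleftrightarrow> xs = xs' \<and> ys = ys'"
  using map_Cons_append_inject by blast

lemmas map_Cons_eq_iffs =
  map_Cons_append_eq_iff
  map_Cons_append_eq_iff[where ys = "[]" and ys' = "[]", simplified]
  map_Cons_append_eq_iff[where ys = "[]" and xs' = "[]", simplified]
  map_Cons_append_eq_iff[where ys = "[]", simplified]
  map_Cons_append_eq_iff[where xs = "[]" and ys' = "[]", simplified]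
  map_Cons_append_eq_iff[where xs = "[]" and xs' = "[]", simplified]
  map_Cons_append_eq_iff[where xs = "[]", simplified]
  map_Cons_append_eq_iff[where ys' = "[]", simplified]
  map_Cons_append_eq_iff[where xs' = "[]", simplified]

lemma codewords_inject: "codewords t = codewords u \<Longrightarrow> t = u"
proof (induction t arbitrary: u)
  case (Symbol a)
  then show ?case
    by (cases u) (auto simp: Cons_eq_append_conv Cons_eq_map_conv)
next
  case (ZeroOnly t)
  then show ?case
    by (cases u) (auto simp: map_Cons_eq_iffs codewords_nonempty codewords_nonempty[symmetric] map_eq_Cons_conv)
next
  case (OneOnly t)
  then show ?case
    by (cases u) (auto simp: map_Cons_eq_iffs codewords_nonempty codewords_nonempty[symmetric] map_eq_Cons_conv)
next
  case (Branch l r)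
  then show ?case
    by (cases u) (auto simp: map_Cons_eq_iffs codewords_nonempty codewords_nonempty[symmetric] append_eq_Cons_conv map_eq_Cons_conv)
qed

lemma codewords_exists:
  fixes ws :: "(bool list \<times> 'a) list"
  assumes "ws \<noteq> []"
    and "sorted_wrt (\<lambda>x y. (fst x, fst y) \<in> lexord {(False, True)} \<and> \<not> prefix (fst x) (fst y)) ws"
  shows "\<exists>t. codewords t = ws"
  using assms
proof (induction "sum_list (map (length \<circ> fst) ws)" arbitrary: ws rule: less_induct)
  case less
  let ?R = "\<lambda>x y :: bool list \<times> 'a.
    (fst x, fst y) \<in> lexord {(False, True)} \<and> \<not> prefix (fst x) (fst y)"
  show ?case
  proof (cases "\<exists>x\<in>set ws. fst x = []")
    case True
    then obtain as a bs where ws: "ws = as @ ([], a) # bs"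
      by (metis prod.collapse split_list)
    have "as = []"
      using less.prems(2) unfolding ws by (cases as) (auto simp: sorted_wrt_append)
    moreover have "bs = []"
      using less.prems(2) unfolding ws by (cases bs) (auto simp: sorted_wrt_append)
    ultimately have "codewords (Symbol a) = ws"
      using ws by simp
    then show ?thesis by blast
  next
    case False
    have "\<exists>xs ys. us = map (apfst (Cons False)) xs @ map (apfst (Cons True)) ys"
      if "sorted_wrt ?R us" "\<forall>x\<in>set us. fst x \<noteq> []" for us
      using that
    proof (induction us)
      case Nil
      then show ?case by simp
    next
      case (Cons u us)
      then obtain xs ys where us: "us = map (apfst (Cons False)) xs @ map (apfst (Cons True)) ys"
        by auto
      obtain b w a where u: "u = (b # w, a)"
        using Cons.prems by (cases u; cases "fst u") auto
      show ?case
      proof (cases b)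
        case True
        have "xs = []"
          using Cons.prems(1) True unfolding us u by (cases xs) auto
        then have "u # us = map (apfst (Cons False)) [] @ map (apfst (Cons True)) ((w, a) # ys)"
          using us u True by simp
        then show ?thesis by blast
      next
        case False
        then have "u # us = map (apfst (Cons False)) ((w, a) # xs) @ map (apfst (Cons True)) ys"
          using us u by simp
        then show ?thesis by blast
      qed
    qed
    then obtain xs ys where ws: "ws = map (apfst (Cons False)) xs @ map (apfst (Cons True)) ys"
      using less.prems False by blast
    have s: "sorted_wrt ?R xs" "sorted_wrt ?R ys"
      using less.prems(2) unfolding ws by (auto simp: sorted_wrt_append sorted_wrt_map)
    have len: "sum_list (map (length \<circ> fst) (map (apfst (Cons b)) zs)) =
        sum_list (map (length \<circ> fst) zs) + length zs" for b and zs :: "(bool list \<times> 'a) list"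
      by (induction zs) auto
    have l: "sum_list (map (length \<circ> fst) ws) =
        sum_list (map (length \<circ> fst) xs) + length xs + (sum_list (map (length \<circ> fst) ys) + length ys)"
      unfolding ws map_append sum_list_append len ..
    have "xs \<noteq> [] \<or> ys \<noteq> []"
      using less.prems(1) ws by auto
    then have m: "sum_list (map (length \<circ> fst) xs) < sum_list (map (length \<circ> fst) ws)"
      "sum_list (map (length \<circ> fst) ys) < sum_list (map (length \<circ> fst) ws)"
      unfolding l by (auto simp flip: length_greater_0_conv)
    have X: "\<exists>t. codewords t = xs" if "xs \<noteq> []"
      using less.hyps[OF m(1) that s(1)] .
    have Y: "\<exists>t. codewords t = ys" if "ys \<noteq> []"
      using less.hyps[OF m(2) that s(2)] .
    consider "xs = []" "ys \<noteq> []" | "xs \<noteq> []" "ys = []" | "xs \<noteq> []" "ys \<noteq> []"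
      using \<open>xs \<noteq> [] \<or> ys \<noteq> []\<close> by blast
    then show ?thesis
    proof cases
      case 1
      then obtain t where "codewords t = ys" using Y by blast
      then have "codewords (OneOnly t) = ws" using ws 1 by simp
      then show ?thesis by blast
    next
      case 2
      then obtain t where "codewords t = xs" using X by blast
      then have "codewords (ZeroOnly t) = ws" using ws 2 by simp
      then show ?thesis by blast
    next
      case 3
      then obtain t u where "codewords t = xs" "codewords u = ys" using X Y by blast
      then have "codewords (Branch t u) = ws" using ws by simp
      then show ?thesis by blast
    qed
  qed
qed

lemma codewords_code_tree:
  assumes "alphabetic_code n C"
  shows "codewords (code_tree n C) = map (\<lambda>j. (C j, j)) [1..<2*n+2]"
proof -
  have "sorted_wrt (\<lambda>x y. (fst x, fst y) \<in> lexord {(False, True)} \<and> \<not> prefix (fst x) (fst y))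
      (map (\<lambda>j. (C j, j)) [1..<2*n+2])"
    unfolding sorted_wrt_map
  proof (rule sorted_wrt_mono_rel[of _ "(<)"])
    fix i j
    assume "i \<in> set [1..<2*n+2]" "j \<in> set [1..<2*n+2]" "i < j"
    then have "i \<in> {1..2*n+1}" "j \<in> {1..2*n+1}" "i < j" by auto
    then show "(fst (C i, i), fst (C j, j)) \<in> lexord {(False, True)} \<and> \<not> prefix (fst (C i, i)) (fst (C j, j))"
      using assms unfolding alphabetic_code_def fst_conv by (metis less_irrefl)
  qed (rule sorted_wrt_upt)
  then obtain t where "codewords t = map (\<lambda>j. (C j, j)) [1..<2*n+2]"
    using codewords_exists[of "map (\<lambda>j. (C j, j)) [1..<2*n+2]"] by auto
  then show ?thesis
    unfolding code_tree_def using codewords_inject by (metis (mono_tags, lifting) theI)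
qed

text \<open>The key \<open>x\<^sub>i\<close> is represented by its index \<open>i\<close>. The leaves of a tree are identified, from left
  to right, with the gaps carrying \<open>p\<^sub>0, \<dots>, p\<^sub>n\<close>.\<close>

definition search_tree :: "nat \<Rightarrow> nat tree \<Rightarrow> bool" where
  "search_tree n T \<longleftrightarrow> inorder T = [1..<n+1]"

text \<open>\<open>levels d T\<close> lists, in the order of the in-order visit, the levels of the internal nodes and the
  levels of the parents of the leaves, when the root of \<open>T\<close> has \<open>d\<close> proper ancestors. So
  \<open>levels 0 T\<close> is \<open>\<ell>(p\<^sub>0), \<ell>(q\<^sub>1), \<ell>(p\<^sub>1), \<dots>, \<ell>(q\<^sub>n), \<ell>(p\<^sub>n)\<close>. If \<open>n = 0\<close>, the only leaf has no parent,
  and its level is taken to be \<open>0\<close>.\<close>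

fun levels :: "nat \<Rightarrow> 'a tree \<Rightarrow> nat list" where
  "levels d Leaf = [d]"
| "levels d (Node l x r) = levels (d + 1) l @ [d + 1] @ levels (d + 1) r"

definition key_level :: "'a tree \<Rightarrow> nat \<Rightarrow> nat" where
  "key_level T i = levels 0 T ! (2 * i - 1)"

definition gap_level :: "'a tree \<Rightarrow> nat \<Rightarrow> nat" where
  "gap_level T i = levels 0 T ! (2 * i)"

definition tree_cost :: "nat \<Rightarrow> (nat \<Rightarrow> real) \<Rightarrow> (nat \<Rightarrow> real) \<Rightarrow> nat tree \<Rightarrow> real" where
  "tree_cost n p q T =
     (\<Sum>i=1..n. q i * real (key_level T i)) + (\<Sum>i=0..n. p i * real (gap_level T i))"

text \<open>Programs of a first-order, call-by-value Lisp-like language. Data are built from null and real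
  numbers by forming cells. The available operations are pairing, projections, tests of the kind of a datum,
  comparison of two numbers, and calls of (mutually recursive) unary functions; there is no
  arithmetic. Each operation costs one unit and takes constant time on a pointer machine or a RAM
  (with unit-cost comparison of the given numbers).

  Variables are de Bruijn indices into the environment. A program is a finite list of function
  bodies, whose only free variable \<open>Var 0\<close> is the argument; execution starts with function \<open>0\<close>.\<close>

datatype data = Null | is_Num: Num real | Cell data data

datatype expr =
    Var nat
  | NullE
  | PairE expr expr
  | Fst expr
  | Snd expr
  | IfNull expr expr expr
  | IfNum expr expr expr
  | IfLess expr expr expr expr
  | LetE expr expr
  | Call nat expr

type_synonym program = "expr list"

inductive eval :: "program \<Rightarrow> data list \<Rightarrow> expr \<Rightarrow> data \<Rightarrow> nat \<Rightarrow> bool" for P where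
  Var: "i < length env \<Longrightarrow> eval P env (Var i) (env ! i) 1"
| NullE: "eval P env NullE Null 1"
| PairE: "eval P env e1 v1 t1 \<Longrightarrow> eval P env e2 v2 t2 \<Longrightarrow>
    eval P env (PairE e1 e2) (Cell v1 v2) (t1 + t2 + 1)"
| Fst: "eval P env e (Cell v1 v2) t \<Longrightarrow> eval P env (Fst e) v1 (t + 1)"
| Snd: "eval P env e (Cell v1 v2) t \<Longrightarrow> eval P env (Snd e) v2 (t + 1)"
| IfNull: "eval P env e v t \<Longrightarrow> eval P env (if v = Null then e1 else e2) v' t' \<Longrightarrow>
    eval P env (IfNull e e1 e2) v' (t + t' + 1)"
| IfNum: "eval P env e v t \<Longrightarrow> eval P env (if is_Num v then e1 else e2) v' t' \<Longrightarrow>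
    eval P env (IfNum e e1 e2) v' (t + t' + 1)"
| IfLess: "eval P env a (Num x) t1 \<Longrightarrow> eval P env b (Num y) t2 \<Longrightarrow>
    eval P env (if x < y then e1 else e2) v t3 \<Longrightarrow>
    eval P env (IfLess a b e1 e2) v (t1 + t2 + t3 + 1)"
| LetE: "eval P env e1 v1 t1 \<Longrightarrow> eval P (v1 # env) e2 v2 t2 \<Longrightarrow>
    eval P env (LetE e1 e2) v2 (t1 + t2 + 1)"
| Call: "eval P env e v t \<Longrightarrow> f < length P \<Longrightarrow> eval P [v] (P ! f) v' t' \<Longrightarrow>
    eval P env (Call f e) v' (t + t' + 1)"

inductive_cases eval_elims:
  "eval P env (Var i) v t"
  "eval P env NullE v t"
  "eval P env (PairE e1 e2) v t"
  "eval P env (Fst e) v t"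
  "eval P env (Snd e) v t"
  "eval P env (IfNull e e1 e2) v t"
  "eval P env (IfNum e e1 e2) v t"
  "eval P env (IfLess a b e1 e2) v t"
  "eval P env (LetE e1 e2) v t"
  "eval P env (Call f e) v t"

lemma eval_deterministic:
  "eval P env e v t \<Longrightarrow> eval P env e v' t' \<Longrightarrow> v' = v \<and> t' = t"
proof (induction arbitrary: v' t' rule: eval.induct)
  case Var from Var.prems show ?case by (rule eval_elims) simp
next
  case NullE from NullE.prems show ?case by (rule eval_elims) simp
next
  case (PairE env e1 v1 t1 e2 v2 t2)
  from PairE.prems obtain va ta vb tb where
    "eval P env e1 va ta" "eval P env e2 vb tb" "v' = Cell va vb" "t' = Suc (ta + tb)"
    by (rule eval_elims) blast
  with PairE.IH(1)[of va ta] PairE.IH(2)[of vb tb] show ?case by simp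
next
  case (Fst env e v1 v2 t)
  from Fst.prems obtain va ta where "eval P env e (Cell v' va) ta" "t' = Suc ta"
    by (rule eval_elims) blast
  with Fst.IH[of "Cell v' va" ta] show ?case by simp
next
  case (Snd env e v1 v2 t)
  from Snd.prems obtain va ta where "eval P env e (Cell va v') ta" "t' = Suc ta"
    by (rule eval_elims) blast
  with Snd.IH[of "Cell va v'" ta] show ?case by simp
next
  case (IfNull env e v t e1 e2 w s)
  from IfNull.prems obtain va ta tb where
    "eval P env e va ta" "eval P env (if va = Null then e1 else e2) v' tb" "t' = Suc (ta + tb)"
    by (rule eval_elims) blast
  with IfNull.IH(1)[of va ta] IfNull.IH(2)[of v' tb] show ?case by simp
next
  case (IfNum env e v t e1 e2 w s)
  from IfNum.prems obtain va ta tb where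
    "eval P env e va ta" "eval P env (if is_Num va then e1 else e2) v' tb" "t' = Suc (ta + tb)"
    by (rule eval_elims) blast
  with IfNum.IH(1)[of va ta] IfNum.IH(2)[of v' tb] show ?case by simp
next
  case (IfLess env a x t1 b y t2 e1 e2 v t3)
  from IfLess.prems obtain x' ta y' tb tc where
    "eval P env a (Num x') ta" "eval P env b (Num y') tb"
    "eval P env (if x' < y' then e1 else e2) v' tc" "t' = Suc (ta + tb + tc)"
    by (rule eval_elims) blast
  with IfLess.IH(1)[of "Num x'" ta] IfLess.IH(2)[of "Num y'" tb] IfLess.IH(3)[of v' tc]
  show ?case by simp
next
  case (LetE env e1 v1 t1 e2 v2 t2)
  from LetE.prems obtain va ta tb where
    "eval P env e1 va ta" "eval P (va # env) e2 v' tb" "t' = Suc (ta + tb)"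
    by (rule eval_elims) blast
  with LetE.IH(1)[of va ta] LetE.IH(2)[of v' tb] show ?case by simp
next
  case (Call env e v t f w s)
  from Call.prems obtain va ta tb where
    "eval P env e va ta" "eval P [va] (P ! f) v' tb" "t' = Suc (ta + tb)"
    by (rule eval_elims) blast
  with Call.IH(1)[of va ta] Call.IH(2)[of v' tb] show ?case by simp
qed

definition runs :: "program \<Rightarrow> data \<Rightarrow> data \<Rightarrow> nat \<Rightarrow> bool" where
  "runs P inp out t \<longleftrightarrow> P \<noteq> [] \<and> eval P [inp] (P ! 0) out t"

text \<open>The input is the tree of the code; the leaf of the \<open>j\<close>-th symbol carries the probability
  \<open>\<sigma>\<^sub>j\<close>, the kind of the symbol (null for \<open>p\<^sub>i\<close>, a cell for \<open>q\<^sub>i\<close>) and the index \<open>i\<close>. A leaf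
  is a cell whose first component is a number, an internal node one whose first component is not; a
  missing child is null.\<close>

fun encode_code_tree :: "(nat \<Rightarrow> real) \<Rightarrow> nat ctree \<Rightarrow> data" where
  "encode_code_tree s (Symbol j) =
     Cell (Num (s j)) (Cell (if odd j then Null else Cell Null Null) (Num (real (j div 2))))"
| "encode_code_tree s (ZeroOnly t) = Cell (encode_code_tree s t) Null"
| "encode_code_tree s (OneOnly t) = Cell Null (encode_code_tree s t)"
| "encode_code_tree s (Branch l r) = Cell (encode_code_tree s l) (encode_code_tree s r)"

fun encode_search_tree :: "nat tree \<Rightarrow> data" where
  "encode_search_tree Leaf = Null"
| "encode_search_tree (Node l i r) =
     Cell (Num (real i)) (Cell (encode_search_tree l) (encode_search_tree r))"

end

theory Submission
  imports Defs
begin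

text \<open>
  The search tree is the tree of \<open>C\<close> restricted to the leaves \<open>p\<^sub>0, \<dots>, p\<^sub>n\<close>: every leaf \<open>q\<^sub>i\<close> is
  deleted, every node left with a single child is contracted, and \<open>q\<^sub>i\<close> becomes the lowest common
  ancestor of \<open>p\<^sub>i\<^sub>-\<^sub>1\<close> and \<open>p\<^sub>i\<close>. In \<open>C\<close> the leaf \<open>q\<^sub>i\<close> lies at least two edges below that
  ancestor, so its level in \<open>T\<close> is at most its depth in \<open>C\<close> minus one. Contracting the parent of
  \<open>q\<^sub>i\<close> lifts the sibling subtree, which contains \<open>p\<^sub>i\<^sub>-\<^sub>1\<close> or \<open>p\<^sub>i\<close>; this saves at least
  \<open>min p\<^sub>i\<^sub>-\<^sub>1 p\<^sub>i\<close>, and the savings for different \<open>i\<close> add up.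
\<close>

section \<open>The restricted tree\<close>

text \<open>The result is \<open>None\<close> if no leaf is a gap. Otherwise the tree comes with the index of its first
  gap, which is the key that separates it from a tree to its left.\<close>

fun gap_tree :: "nat ctree \<Rightarrow> (nat \<times> nat tree) option" where
  "gap_tree (Symbol j) = (if odd j then Some (j div 2, Leaf) else None)"
| "gap_tree (ZeroOnly t) = gap_tree t"
| "gap_tree (OneOnly t) = gap_tree t"
| "gap_tree (Branch l r) =
     (case gap_tree l of
        None \<Rightarrow> gap_tree r
      | Some (i, T) \<Rightarrow>
          (case gap_tree r of
             None \<Rightarrow> Some (i, T)
           | Some (k, U) \<Rightarrow> Some (i, Node T k U)))"

definition symbols :: "'a ctree \<Rightarrow> 'a list" where
  "symbols t = map snd (codewords t)"

lemma symbols_simps [simp]: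
  "symbols (Symbol a) = [a]"
  "symbols (ZeroOnly t) = symbols t"
  "symbols (OneOnly t) = symbols t"
  "symbols (Branch l r) = symbols l @ symbols r"
  by (simp_all add: symbols_def comp_def)

lemma symbols_nonempty: "symbols t \<noteq> []"
  by (simp add: symbols_def codewords_nonempty)

lemma symbols_less: "symbols t = [a..<b] \<Longrightarrow> a < b"
  using symbols_nonempty[of t] by (metis not_le upt_conv_Nil)

lemma singleton_eq_uptD: "[j] = [a..<b] \<Longrightarrow> a = j \<and> b = Suc j"
  using upt_eq_Cons_conv[of a b j "[]"] by auto

lemma append_eq_uptD:
  assumes "xs @ ys = [a..<b]" "xs \<noteq> []" "ys \<noteq> []"
  obtains m where "xs = [a..<m]" "ys = [m..<b]" "a < m" "m < b"
proof
  let ?m = "a + length xs"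
  have len: "length xs + length ys = b - a"
    using assms(1) by (metis length_append length_upt)
  have pos: "0 < length xs" "0 < length ys" using assms(2,3) by auto
  show "a < ?m" "?m < b" using len pos by linarith+
  then show "xs = [a..<?m]" "ys = [?m..<b]"
    using arg_cong[OF assms(1), of "take (length xs)"] arg_cong[OF assms(1), of "drop (length xs)"]
    by (simp_all add: take_upt)
qed

text \<open>Gaps sit at odd positions and keys at even ones, so consecutive symbols without a gap
  form a single key: two adjacent gap-free blocks would both start at an even position.\<close>

lemma gap_tree_None:
  assumes "symbols t = [a..<b]" "gap_tree t = None"
  shows "even a \<and> b = Suc a"
  using assms
proof (induction t arbitrary: a b)
  case (Symbol j)
  then show ?case by (auto dest!: singleton_eq_uptD split: if_splits)
next
  case (Branch l r)
  obtain m where m: "symbols l = [a..<m]" "symbols r = [m..<b]"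
    using append_eq_uptD[of "symbols l" "symbols r" a b] Branch.prems(1) symbols_nonempty by auto
  show ?case
    using Branch.IH(1)[OF m(1)] Branch.IH(2)[OF m(2)] Branch.prems(2)
    by (auto split: option.splits)
qed auto

text \<open>Position \<open>2 * i + 1\<close> lies in \<open>[a..<b]\<close> iff
  \<open>a div 2 \<le> i < b div 2\<close>. Only keys between two of these gaps enter the tree; a
  key at either end is left to an ancestor.\<close>

lemma gap_tree_Some:
  assumes "symbols t = [a..<b]" "gap_tree t = Some (i, T)"
  shows "i = a div 2 \<and> a div 2 < b div 2 \<and> inorder T = [Suc i..<b div 2]"
  using assms
proof (induction t arbitrary: a b i T)
  case (Symbol j)
  then show ?case by (auto dest!: singleton_eq_uptD split: if_splits elim!: oddE)
next
  case (Branch l r)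
  obtain m where m: "symbols l = [a..<m]" "symbols r = [m..<b]" "a < m" "m < b"
    using append_eq_uptD[of "symbols l" "symbols r" a b] Branch.prems(1) symbols_nonempty by auto
  consider "gap_tree l = None" "gap_tree r = Some (i, T)"
    | "gap_tree l = Some (i, T)" "gap_tree r = None"
    | L k R where "gap_tree l = Some (i, L)" "gap_tree r = Some (k, R)" "T = Node L k R"
    using Branch.prems(2) by (auto split: option.splits)
  then show ?case
  proof cases
    case 1
    \<comment> \<open>Dropping the key at the even position \<open>a\<close> keeps the range of
      gaps, since \<open>Suc a div 2 = a div 2\<close>.\<close>
    then have "even a" "m = Suc a" using gap_tree_None[OF m(1)] by auto
    then show ?thesis using Branch.IH(2)[OF m(2) 1(2)] by simp
  next
    case 2
    then have "even m" "b = Suc m" using gap_tree_None[OF m(2)] by auto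
    then show ?thesis using Branch.IH(1)[OF m(1) 2(1)] by simp
  next
    case 3
    have ih: "i = a div 2" "k = m div 2" "a div 2 < m div 2" "m div 2 < b div 2"
      "inorder L = [Suc i..<m div 2]" "inorder R = [Suc k..<b div 2]"
      using Branch.IH(1)[OF m(1) 3(1)] Branch.IH(2)[OF m(2) 3(2)] by auto
    \<comment> \<open>The root key is \<open>m div 2\<close>, the index of the first gap on the
      right, whether its leaf in the code is the last of \<open>l\<close> or the first of
      \<open>r\<close>.\<close>
    have "[Suc i..<b div 2] = [Suc i..<m div 2] @ m div 2 # [Suc (m div 2)..<b div 2]"
      using ih(1,3,4) by (metis Suc_leI le_add_diff_inverse less_imp_le upt_add_eq_append upt_conv_Cons)
    then show ?thesis using ih 3(3) by simp
  qed
qed auto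

section \<open>Costs\<close>

text \<open>The offset \<open>c\<close> lets a subtree be priced by positions of the whole sequence,
  from its first gap on.\<close>

definition list_cost :: "(nat \<Rightarrow> real) \<Rightarrow> nat \<Rightarrow> nat list \<Rightarrow> real" where
  "list_cost s c xs = (\<Sum>k<length xs. s (c + k) * real (xs ! k))"

lemma list_cost_Nil [simp]: "list_cost s c [] = 0"
  by (simp add: list_cost_def)

lemma list_cost_Cons [simp]: "list_cost s c (x # xs) = s c * real x + list_cost s (Suc c) xs"
  unfolding list_cost_def length_Cons sum.lessThan_Suc_shift by simp

lemma list_cost_append:
  "list_cost s c (xs @ ys) = list_cost s c xs + list_cost s (c + length xs) ys"
  by (induction xs arbitrary: c) auto

lemma list_cost_map_Suc:
  "list_cost s c (map Suc xs) = list_cost s c xs + sum s {c..<c + length xs}"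
  by (induction xs arbitrary: c) (auto simp: algebra_simps sum.atLeast_Suc_lessThan)

lemma levels_Suc: "levels (Suc d) T = map Suc (levels d T)"
  by (induction T arbitrary: d) auto

lemma length_levels: "length (levels d T) = Suc (2 * length (inorder T))"
  by (induction T arbitrary: d) auto

definition leaf_cost :: "('a \<Rightarrow> real) \<Rightarrow> 'a ctree \<Rightarrow> real" where
  "leaf_cost s t = (\<Sum>(w, a)\<leftarrow>codewords t. s a * real (length w))"

lemma sum_list_map_apfst_Cons:
  "(\<Sum>(w, a)\<leftarrow>map (apfst (Cons b)) ws. s a * real (length w)) =
   (\<Sum>(w, a)\<leftarrow>ws. s a * real (length w)) + (\<Sum>a\<leftarrow>map snd ws. s a)"
  for s :: "'a \<Rightarrow> real"
  by (induction ws) (auto simp: algebra_simps)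

lemma leaf_cost_simps [simp]:
  "leaf_cost s (Symbol a) = 0"
  "leaf_cost s (ZeroOnly t) = leaf_cost s t + sum_list (map s (symbols t))"
  "leaf_cost s (OneOnly t) = leaf_cost s t + sum_list (map s (symbols t))"
  "leaf_cost s (Branch l r) =
     leaf_cost s l + sum_list (map s (symbols l)) + (leaf_cost s r + sum_list (map s (symbols r)))"
  by (simp_all add: leaf_cost_def symbols_def sum_list_map_apfst_Cons del: map_map)

lemma leaf_cost_nonneg:
  assumes "\<And>a. a \<in> set (symbols t) \<Longrightarrow> 0 \<le> s a"
  shows "0 \<le> leaf_cost s t"
  unfolding leaf_cost_def using assms by (force simp: symbols_def intro!: sum_list_nonneg mult_nonneg_nonneg)

text \<open>The neighbours of \<open>j\<close> may lie outside the subtree considered; the minimum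
  is then bounded by the one inside.\<close>

definition saving :: "(nat \<Rightarrow> real) \<Rightarrow> nat \<Rightarrow> real" where
  "saving s j = (if even j then s j + min (s (j - 1)) (s (Suc j)) else 0)"

text \<open>Each key is dropped exactly once, at the branch where it meets a sibling containing a
  gap, and its saving is paid for there. The left side omits keys at the ends of the range, but
  their savings are already counted.\<close>

lemma gap_tree_cost:
  assumes "symbols t = [a..<b]" "gap_tree t = Some (i, T)"
    and "\<And>j. j \<in> {a..<b} \<Longrightarrow> 0 \<le> s j"
  shows "list_cost s (Suc (2 * i)) (levels 0 T) \<le> leaf_cost s t - sum (saving s) {a..<b}"
  using assms
proof (induction t arbitrary: a b i T)
  case (Symbol j)
  then show ?case by (auto simp: saving_def dest!: singleton_eq_uptD split: if_splits)
next
  case (ZeroOnly t)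
  then have "0 \<le> sum s {a..<b}" by (auto intro: sum_nonneg)
  moreover have "list_cost s (Suc (2 * i)) (levels 0 T) \<le> leaf_cost s t - sum (saving s) {a..<b}"
    using ZeroOnly.prems by (intro ZeroOnly.IH) auto
  ultimately show ?case
    using ZeroOnly.prems(1) by (simp add: interv_sum_list_conv_sum_set_nat)
next
  case (OneOnly t)
  then have "0 \<le> sum s {a..<b}" by (auto intro: sum_nonneg)
  moreover have "list_cost s (Suc (2 * i)) (levels 0 T) \<le> leaf_cost s t - sum (saving s) {a..<b}"
    using OneOnly.prems by (intro OneOnly.IH) auto
  ultimately show ?case
    using OneOnly.prems(1) by (simp add: interv_sum_list_conv_sum_set_nat)
next
  case (Branch l r)
  obtain m where m: "symbols l = [a..<m]" "symbols r = [m..<b]" "a < m" "m < b"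
    using append_eq_uptD[of "symbols l" "symbols r" a b] Branch.prems(1) symbols_nonempty by auto
  have nonneg: "0 \<le> s j" if "j \<in> {a..<b}" for j
    using Branch.prems(3) that .
  have cost: "leaf_cost s (Branch l r) =
      leaf_cost s l + leaf_cost s r + sum s {a..<m} + sum s {m..<b}"
    by (simp add: m interv_sum_list_conv_sum_set_nat)
  have split: "sum f {a..<b} = sum f {a..<m} + sum f {m..<b}" for f :: "nat \<Rightarrow> real"
    using m by (simp add: sum.atLeastLessThan_concat)
  have pos: "0 \<le> sum s {a..<m}" "0 \<le> sum s {m..<b}" "0 \<le> leaf_cost s l" "0 \<le> leaf_cost s r"
    using m nonneg by (auto intro!: sum_nonneg leaf_cost_nonneg)
  consider "gap_tree l = None" "gap_tree r = Some (i, T)"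
    | "gap_tree l = Some (i, T)" "gap_tree r = None"
    | L k R where "gap_tree l = Some (i, L)" "gap_tree r = Some (k, R)" "T = Node L k R"
    using Branch.prems(2) by (auto split: option.splits)
  then show ?case
  proof cases
    case 1
    then have a: "even a" "m = Suc a" using gap_tree_None[OF m(1)] by auto
    \<comment> \<open>Contraction frees the weight of both children: that of the key at
      \<open>a\<close>, and that of \<open>r\<close>, which includes its neighbour
      \<open>m\<close>.\<close>
    have "s m \<le> sum s {m..<b}"
      using m nonneg by (intro member_le_sum) auto
    then have "saving s a \<le> sum s {a..<m} + sum s {m..<b}"
      using a by (simp add: saving_def)
    moreover have "list_cost s (Suc (2 * i)) (levels 0 T) \<le> leaf_cost s r - sum (saving s) {m..<b}"
      using m nonneg by (intro Branch.IH(2)[OF m(2) 1(2)]) auto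
    ultimately show ?thesis
      using pos a unfolding cost split by simp
  next
    case 2
    then have b: "even m" "b = Suc m" using gap_tree_None[OF m(2)] by auto
    have "s (m - 1) \<le> sum s {a..<m}"
      using m nonneg by (intro member_le_sum) auto
    then have "saving s m \<le> sum s {a..<m} + sum s {m..<b}"
      using b by (simp add: saving_def)
    moreover have "list_cost s (Suc (2 * i)) (levels 0 T) \<le> leaf_cost s l - sum (saving s) {a..<m}"
      using m nonneg by (intro Branch.IH(1)[OF m(1) 2(1)]) auto
    ultimately show ?thesis
      using pos b unfolding cost split by simp
  next
    case 3
    have idx: "i = a div 2" "k = m div 2" "i < k" "k < b div 2"
      and len: "length (levels 0 L) = Suc (2 * (k - Suc i))"
        "length (levels 0 R) = Suc (2 * (b div 2 - Suc k))"
      using gap_tree_Some[OF m(1) 3(1)] gap_tree_Some[OF m(2) 3(2)] by (simp_all add: length_levels)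
    \<comment> \<open>The levels of \<open>L\<close> end just before position \<open>2 * k\<close>
      of the root key, and those of \<open>R\<close> start just after it. This key was omitted in
      both subtrees, so it enters afresh at level 1.\<close>
    have ends: "Suc (2 * i) + length (levels 0 L) = 2 * k"
      "Suc (2 * k) + length (levels 0 R) = 2 * (b div 2)"
      unfolding len using idx(3,4) by auto
    have "list_cost s (Suc (2 * i)) (levels 0 T) =
        list_cost s (Suc (2 * i)) (levels 0 L) + list_cost s (Suc (2 * k)) (levels 0 R) +
        (sum s {Suc (2 * i)..<2 * k} + s (2 * k) + sum s {Suc (2 * k)..<2 * (b div 2)})"
      using 3(3) ends by (simp add: list_cost_append levels_Suc list_cost_map_Suc)
    also have "sum s {Suc (2 * i)..<2 * k} + s (2 * k) + sum s {Suc (2 * k)..<2 * (b div 2)} =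
        sum s {Suc (2 * i)..<2 * (b div 2)}"
      using idx(3,4) sum.atLeastLessThan_concat[of "Suc (2 * i)" "2 * k" "2 * (b div 2)" s]
      by (simp add: sum.atLeast_Suc_lessThan[of "2 * k"])
    \<comment> \<open>Only keys at the two ends are added, with nonnegative weight.\<close>
    also have "\<dots> \<le> sum s {a..<b}"
      using idx nonneg by (intro sum_mono2) auto
    finally have "list_cost s (Suc (2 * i)) (levels 0 T) \<le>
        list_cost s (Suc (2 * i)) (levels 0 L) + list_cost s (Suc (2 * k)) (levels 0 R) + sum s {a..<b}"
      by simp
    moreover have "list_cost s (Suc (2 * i)) (levels 0 L) \<le> leaf_cost s l - sum (saving s) {a..<m}"
      using m nonneg by (intro Branch.IH(1)[OF m(1) 3(1)]) auto
    moreover have "list_cost s (Suc (2 * k)) (levels 0 R) \<le> leaf_cost s r - sum (saving s) {m..<b}"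
      using m nonneg by (intro Branch.IH(2)[OF m(2) 3(2)]) auto
    ultimately show ?thesis
      unfolding cost split by simp
  qed
qed

section \<open>From positions to keys and gaps\<close>

lemma sum_even_odd:
  "(\<Sum>j=1..2*n+1. f j) = (\<Sum>i=1..n. f (2 * i)) + (\<Sum>i=0..n. f (2 * i + 1))"
  for f :: "nat \<Rightarrow> 'a::comm_monoid_add"
  by (induction n) (simp_all add: ac_simps)

lemma leaf_cost_code_tree:
  assumes "alphabetic_code n C"
  shows "leaf_cost (sigma p q) (code_tree n C) = code_cost n p q C"
  unfolding leaf_cost_def codewords_code_tree[OF assms] code_cost_def
  by (simp add: comp_def interv_sum_list_conv_sum_set_nat atLeastLessThanSuc_atLeastAtMost
      del: upt_Suc)

lemma tree_cost_eq_list_cost: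
  assumes "search_tree n T"
  shows "tree_cost n p q T = list_cost (sigma p q) 1 (levels 0 T)"
proof -
  have "length (levels 0 T) = 2 * n + 1"
    using assms by (simp add: length_levels search_tree_def)
  then have "list_cost (sigma p q) 1 (levels 0 T) =
      (\<Sum>j=1..2*n+1. sigma p q j * real (levels 0 T ! (j - 1)))"
    unfolding list_cost_def by (intro sum.reindex_bij_witness[of _ "\<lambda>j. j - 1" Suc]) auto
  then show ?thesis
    unfolding sum_even_odd by (simp add: tree_cost_def key_level_def gap_level_def sigma_def)
qed

lemma sum_saving_sigma:
  "sum (saving (sigma p q)) {1..2*n+1} = (\<Sum>i=1..n. q i) + (\<Sum>i\<in>{0..<n}. min (p i) (p (i + 1)))"
proof -
  have "saving (sigma p q) (2 * i) = q i + min (p (i - 1)) (p i)" if i: "i \<in> {1..n}" for i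
  proof -
    obtain k where "i = Suc k" using i by (cases i) auto
    then show ?thesis by (simp add: saving_def sigma_def)
  qed
  then have "sum (saving (sigma p q)) {1..2*n+1} = (\<Sum>i=1..n. q i + min (p (i - 1)) (p i))"
    unfolding sum_even_odd by (simp add: saving_def)
  also have "\<dots> = (\<Sum>i=1..n. q i) + (\<Sum>i=1..n. min (p (i - 1)) (p i))"
    by (rule sum.distrib)
  also have "(\<Sum>i=1..n. min (p (i - 1)) (p i)) = (\<Sum>i\<in>{0..<n}. min (p i) (p (i + 1)))"
    by (rule sum.reindex_bij_witness[of _ Suc "\<lambda>i. i - 1"]) auto
  finally show ?thesis .
qed

section \<open>The program\<close>

text \<open>Null serves both as a missing child and as the result \<open>None\<close>, so unary
  nodes need no case of their own. Inside both lets, \<open>Var (Suc 0)\<close> is the left result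
  and \<open>Var 0\<close> the right one.\<close>

definition restrict_body :: expr where
  "restrict_body =
     IfNull (Var 0) NullE
      (IfNum (Fst (Var 0))
        (IfNull (Fst (Snd (Var 0))) (PairE (Snd (Snd (Var 0))) NullE) NullE)
        (LetE (Call (Suc 0) (Fst (Var 0)))
          (LetE (Call (Suc 0) (Snd (Var (Suc 0))))
            (IfNull (Var (Suc 0)) (Var 0)
              (IfNull (Var 0) (Var (Suc 0))
                (PairE (Fst (Var (Suc 0)))
                  (PairE (Fst (Var 0)) (PairE (Snd (Var (Suc 0))) (Snd (Var 0))))))))))"

definition restrict_program :: program where
  "restrict_program = [Snd (Call (Suc 0) (Var 0)), restrict_body]"

text \<open>The cell with the index keeps a lone gap, whose tree is null, apart from
  \<open>None\<close>.\<close>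

fun encode_gap_tree :: "(nat \<times> nat tree) option \<Rightarrow> data" where
  "encode_gap_tree None = Null"
| "encode_gap_tree (Some (i, T)) = Cell (Num (real i)) (encode_search_tree T)"

lemma eval_Var_0: "eval P (v # env) (Var 0) v 1"
  using eval.Var[of 0 "v # env"] by simp

lemma eval_Var_Suc: "eval P (w # v # env) (Var (Suc 0)) v 1"
  using eval.Var[of "Suc 0" "w # v # env"] by simp

lemma eval_if_True: "c \<Longrightarrow> eval P env e1 v t \<Longrightarrow> eval P env (if c then e1 else e2) v t"
  by simp

lemma eval_if_False: "\<not> c \<Longrightarrow> eval P env e2 v t \<Longrightarrow> eval P env (if c then e1 else e2) v t"
  by simp

text \<open>Keeps the called body folded, so that recursive calls are closed by known runs.\<close>

lemma eval_Call_restrict: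
  "eval restrict_program env e v t \<Longrightarrow> eval restrict_program [v] restrict_body w t' \<Longrightarrow>
   eval restrict_program env (Call (Suc 0) e) w (t + t' + 1)"
  using eval.Call[of restrict_program env e v t "Suc 0"] by (simp add: restrict_program_def)

text \<open>Resolution with these rules runs a program symbolically; unification computes the time.\<close>

lemmas eval_rules = eval_Var_0 eval_Var_Suc eval_Call_restrict
  eval.NullE eval.PairE eval.Fst eval.Snd eval.LetE eval.IfNull eval.IfNum
  eval_if_True[OF refl] eval_if_False[OF data.distinct(4)] eval_if_True[OF data.disc(2)]
  eval_if_False[OF data.disc(3)]

lemma eval_restrict_Null: "eval restrict_program [Null] restrict_body Null 3"
proof -
  have "eval restrict_program [Null] restrict_body Null (1 + 1 + 1)"
    by (subst restrict_body_def) (rule eval_rules)+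
  then show ?thesis by (simp add: eval_nat_numeral)
qed

text \<open>With \<open>x\<close> and \<open>y\<close> arbitrary data, this covers unary and binary
  nodes alike; 30 bounds the work outside the two recursive calls.\<close>

lemma eval_restrict_node:
  fixes a b :: "(nat \<times> nat tree) option"
  assumes "eval restrict_program [x] restrict_body (encode_gap_tree a) ta"
    and "eval restrict_program [y] restrict_body (encode_gap_tree b) tb"
    and "\<not> is_Num x"
  shows "\<exists>t. eval restrict_program [Cell x y] restrict_body
      (encode_gap_tree
        (case a of
           None \<Rightarrow> b
         | Some (i, T) \<Rightarrow> (case b of None \<Rightarrow> a | Some (k, U) \<Rightarrow> Some (i, Node T k U)))) t \<and>
    t \<le> ta + tb + 30"
proof -
  consider "a = None" | i T where "a = Some (i, T)" "b = None"
    | i T k U where "a = Some (i, T)" "b = Some (k, U)"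
    by (metis option.exhaust prod.exhaust)
  then show ?thesis
  proof cases
    case 1
    have "eval restrict_program [x] restrict_body Null ta"
      using assms(1) 1 by simp
    note runs = this assms(2)
    show ?thesis
      unfolding 1 option.case
      \<comment> \<open>The time stays schematic until the run determines it; \<open>simp\<close>
        then checks the bound.\<close>
      by (subst restrict_body_def, rule exI, rule conjI,
          (rule eval_rules runs eval_if_False[OF assms(3)])+, simp)
  next
    case 2
    have "eval restrict_program [x] restrict_body (Cell (Num (real i)) (encode_search_tree T)) ta"
      "eval restrict_program [y] restrict_body Null tb"
      using assms(1,2) 2 by simp_all
    note runs = this
    show ?thesis
      unfolding 2 option.case prod.case encode_gap_tree.simps
      by (subst restrict_body_def, rule exI, rule conjI,
          (rule eval_rules runs eval_if_False[OF assms(3)])+, simp)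
  next
    case 3
    have "eval restrict_program [x] restrict_body (Cell (Num (real i)) (encode_search_tree T)) ta"
      "eval restrict_program [y] restrict_body (Cell (Num (real k)) (encode_search_tree U)) tb"
      using assms(1,2) 3 by simp_all
    note runs = this
    show ?thesis
      unfolding 3 option.case prod.case encode_gap_tree.simps encode_search_tree.simps
      by (subst restrict_body_def, rule exI, rule conjI,
          (rule eval_rules runs eval_if_False[OF assms(3)])+, simp)
  qed
qed

lemma is_Num_encode_code_tree [simp]: "\<not> is_Num (encode_code_tree s t)"
  by (cases t) auto

text \<open>A unary node costs at most 30 plus 3 for the call on null, within the 40 allotted per
  node.\<close>

lemma eval_restrict:
  "\<exists>u. eval restrict_program [encode_code_tree s t] restrict_body (encode_gap_tree (gap_tree t)) u \<and>
     u \<le> 40 * nodes t"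
proof (induction t)
  case (Symbol j)
  show ?case
  proof (cases "odd j")
    case True
    show ?thesis
      unfolding encode_code_tree.simps gap_tree.simps if_P[OF True] encode_gap_tree.simps
        encode_search_tree.simps
      by (subst restrict_body_def, rule exI, rule conjI, (rule eval_rules)+, simp)
  next
    case False
    show ?thesis
      unfolding encode_code_tree.simps gap_tree.simps if_not_P[OF False] encode_gap_tree.simps
      by (subst restrict_body_def, rule exI, rule conjI, (rule eval_rules)+, simp)
  qed
next
  case (ZeroOnly t)
  then obtain u where u: "eval restrict_program [encode_code_tree s t] restrict_body
      (encode_gap_tree (gap_tree t)) u" "u \<le> 40 * nodes t"
    by blast
  obtain v where "eval restrict_program [Cell (encode_code_tree s t) Null] restrict_body
      (encode_gap_tree (gap_tree t)) v" "v \<le> u + 3 + 30"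
    using eval_restrict_node[where b = None, OF u(1)] eval_restrict_Null
    by (fastforce split: option.splits)
  then show ?case using u(2) by (intro exI[of _ v]) simp
next
  case (OneOnly t)
  then obtain u where u: "eval restrict_program [encode_code_tree s t] restrict_body
      (encode_gap_tree (gap_tree t)) u" "u \<le> 40 * nodes t"
    by blast
  obtain v where "eval restrict_program [Cell Null (encode_code_tree s t)] restrict_body
      (encode_gap_tree (gap_tree t)) v" "v \<le> 3 + u + 30"
    using eval_restrict_node[where a = None, OF _ u(1)] eval_restrict_Null by fastforce
  then show ?case using u(2) by (intro exI[of _ v]) simp
next
  case (Branch l r)
  then obtain u v where uv:
    "eval restrict_program [encode_code_tree s l] restrict_body (encode_gap_tree (gap_tree l)) u"
    "u \<le> 40 * nodes l"
    "eval restrict_program [encode_code_tree s r] restrict_body (encode_gap_tree (gap_tree r)) v"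
    "v \<le> 40 * nodes r"
    by blast
  obtain w where "eval restrict_program [encode_code_tree s (Branch l r)] restrict_body
      (encode_gap_tree (gap_tree (Branch l r))) w" "w \<le> u + v + 30"
    using eval_restrict_node[OF uv(1,3) is_Num_encode_code_tree]
    by (auto split: option.splits)
  then show ?case using uv(2,4) by (intro exI[of _ w]) simp
qed

theorem theorem5:
  shows "\<exists>(P :: program) (c :: nat). \<forall>(n :: nat) (p :: nat \<Rightarrow> real) (q :: nat \<Rightarrow> real) (C :: nat \<Rightarrow> bool list).
    distribution n p q \<longrightarrow> alphabetic_code n C \<longrightarrow>
    (\<exists>(T :: nat tree) (t :: nat).
       runs P (encode_code_tree (sigma p q) (code_tree n C)) (encode_search_tree T) t \<and>
       t \<le> c * nodes (code_tree n C) \<and>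
       search_tree n T \<and>
       tree_cost n p q T \<le>
         code_cost n p q C - (\<Sum>i=1..n. q i) - (\<Sum>i\<in>{0..<n}. min (p i) (p (i + 1))))"
proof (rule exI[of _ restrict_program], rule exI[of _ 43], intro allI impI)
  fix n p q C
  assume dist: "distribution n p q" and code: "alphabetic_code n C"
  let ?t = "code_tree n C" and ?s = "sigma p q"
  have sym: "symbols ?t = [1..<2 * n + 2]"
    unfolding symbols_def codewords_code_tree[OF code] by (simp add: comp_def del: upt_Suc)
  \<comment> \<open>The range starts at the odd position 1, so there is a gap, and the first one has
    index \<open>1 div 2 = 0\<close>.\<close>
  obtain i T where T: "gap_tree ?t = Some (i, T)"
    using gap_tree_None[OF sym] by fastforce
  have "i = 0" and search: "search_tree n T"
    using gap_tree_Some[OF sym T] by (auto simp: search_tree_def)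
  have "list_cost ?s 1 (levels 0 T) \<le> leaf_cost ?s ?t - sum (saving ?s) {1..2 * n + 1}"
    using gap_tree_cost[OF sym T, of ?s] dist \<open>i = 0\<close>
    by (auto simp: distribution_def atLeastLessThanSuc_atLeastAtMost)
  then have cost: "tree_cost n p q T \<le>
      code_cost n p q C - (\<Sum>i=1..n. q i) - (\<Sum>i\<in>{0..<n}. min (p i) (p (i + 1)))"
    unfolding tree_cost_eq_list_cost[OF search] leaf_cost_code_tree[OF code] sum_saving_sigma
    by simp
  obtain u where u: "eval restrict_program [encode_code_tree ?s ?t] restrict_body
      (Cell (Num (real i)) (encode_search_tree T)) u" "u \<le> 40 * nodes ?t"
    using eval_restrict[of ?s ?t] T by auto
  have "eval restrict_program [encode_code_tree ?s ?t] (Snd (Call (Suc 0) (Var 0)))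
      (encode_search_tree T) (1 + u + 1 + 1)"
    by (rule eval_rules u)+
  then have "runs restrict_program (encode_code_tree ?s ?t) (encode_search_tree T) (u + 3)"
    by (simp add: runs_def restrict_program_def eval_nat_numeral)
  \<comment> \<open>The 3 steps of function 0 are absorbed because a tree has at least one
    node.\<close>
  moreover have "u + 3 \<le> 43 * nodes ?t"
    using u(2) by (cases ?t) auto
  ultimately show "\<exists>T t. runs restrict_program (encode_code_tree ?s ?t) (encode_search_tree T) t \<and>
      t \<le> 43 * nodes ?t \<and> search_tree n T \<and>
      tree_cost n p q T \<le>
        code_cost n p q C - (\<Sum>i=1..n. q i) - (\<Sum>i\<in>{0..<n}. min (p i) (p (i + 1)))"
    using search cost by blast
qed

end
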